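(* Every nonzero term of the Binary Two-Up Sequence $\{a(n)\}_{n\ge 0}$ has weight $1$ or $2$.
   Context: Two nonnegative integers are perpendicular if their binary expansions have no $1$ in the same bit-position. The Binary Two-Up Sequence $\{a(n)\}_{n\ge 0}$ is defined by: for each $n\ge 0$, $a(n)$ is the smallest nonnegative integer not among $a(0),\ldots,a(n-1)$ that is perpendicular to each of $a(\lceil n/2\rceil),\ldots,a(n-1)$, i.e. to each of the previous $\lfloor n/2\rfloor$ terms. It begins $0,1,2,4,8,3,16,32,64,12,128,\ldots$. The weight of a nonnegative integer is the number of $1$'s in its binary expansion. *)

theory Defs
  imports Main
begin

definition perpendicular :: "nat \<Rightarrow> nat \<Rightarrow> bool" where
  "perpendicular x y \<longleftrightarrow> \<not> (\<exists>i. bit x i \<and> bit y i)"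

definition weight :: "nat \<Rightarrow> nat" where
  "weight x = card {i. bit x i}"

text \<open>
  \<open>(n + 1) div 2\<close> is the ceiling of \<open>n / 2\<close>. The \<open>LEAST\<close> is never vacuous: a power of two
  exceeding all of the earlier terms satisfies both conditions. For \<open>n = 0\<close> and \<open>n = 1\<close>
  no perpendicularity is required.
\<close>

function two_up :: "nat \<Rightarrow> nat" where
  "two_up n = (LEAST x. (\<forall>k\<in>{0..<n}. x \<noteq> two_up k) \<and>
                        (\<forall>k\<in>{(n + 1) div 2..<n}. perpendicular x (two_up k)))"
  by pat_completeness auto
termination
  by (relation "measure id") auto

declare two_up.simps [simp del]

end

theory Submission
  imports Defs
begin

text \<open>
  Say that a bit is free at step \<open>n\<close> if it has occurred before \<open>n\<close> but in none of the terms
  that \<open>a(n)\<close> must avoid. Minimality of \<open>a(n)\<close> means: if some set of free bits has not been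
  used, then \<open>a(n)\<close> consists of free bits and no unused set is properly contained in it;
  otherwise \<open>a(n)\<close> is the next power of two. Between consecutive steps the free set loses the
  bits of the term just chosen, and at step \<open>2 * m + 1\<close> it also gains the bits of \<open>a(m)\<close>.
  Hence the weights on indices \<open>12 * r + 3, \<dots>, 12 * r + 14\<close> are governed by those on indices
  \<open>6 * r + 1, \<dots>, 6 * r + 6\<close>. In blocks \<open>6 * q + 3, \<dots>, 6 * q + 8\<close> the weights follow one of
  two patterns: the regular one \<open>1, 1, 2, 1, 2, 1\<close> and the special one \<open>2, 1, 1, 1, 2, 1\<close>.
  A regular block \<open>r\<close> makes \<open>2 * r\<close> and \<open>2 * r + 1\<close> regular; a special block \<open>r\<close> makes
  \<open>2 * r\<close> regular, ending with one surplus free bit, which makes \<open>2 * r + 1\<close> special and is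
  absorbed there. There are never more than three free bits, and whenever there are three, one
  pair of them is used and another is not, so that weight three does not occur.
\<close>

section \<open>Binary expansions as finite sets of bits\<close>

definition bits :: "nat \<Rightarrow> nat set" where
  "bits x = {i. bit x i}"

lemma bits_inject: "bits x = bits y \<longleftrightarrow> x = y"
  by (auto simp: bits_def bit_eq_iff)

lemma bits_zero [simp]: "bits 0 = {}"
  by (simp add: bits_def)

lemma bits_power_two [simp]: "bits (2 ^ c) = {c}"
  by (auto simp: bits_def bit_exp_iff)

lemma perpendicular_iff_bits: "perpendicular x y \<longleftrightarrow> bits x \<inter> bits y = {}"
  by (auto simp: perpendicular_def bits_def)

lemma bit_nat_imp_power_le:
  fixes x :: nat
  assumes "bit x i" shows "2 ^ i \<le> x"
proof (rule ccontr)
  assume "\<not> 2 ^ i \<le> x"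
  then have "x div 2 ^ i = 0" by simp
  with assms show False by (simp add: bit_iff_odd)
qed

lemma finite_bits [simp]: "finite (bits x)"
proof -
  have "i < x" if "bit x i" for i
    using bit_nat_imp_power_le[OF that] less_exp[of i] by linarith
  then have "bits x \<subseteq> {..<x}" by (auto simp: bits_def)
  then show ?thesis by (rule finite_subset) simp
qed

lemma ex_bits_eq:
  assumes "finite T" shows "\<exists>x. bits x = T"
  using assms
proof (induction T)
  case empty
  show ?case by (rule exI[of _ 0]) simp
next
  case (insert a T)
  then obtain x where "bits x = T" by blast
  then have "bits (set_bit a x) = insert a T"
    by (auto simp: bits_def bit_set_bit_iff)
  then show ?case by blast
qed

lemma bits_subset_imp_le:
  assumes "bits x \<subseteq> bits y" shows "x \<le> y"
proof -
  have "x = and x y"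
    using assms by (intro bit_eqI) (auto simp: bits_def bit_and_iff)
  moreover have "int (and x y) \<le> int y"
    unfolding of_nat_and_eq by (rule AND_upper2) simp
  ultimately show ?thesis by linarith
qed

lemma bits_less_imp_less_power:
  assumes "bits x \<subseteq> {..<c}" shows "x < 2 ^ c"
proof -
  have "x = take_bit c x"
    using assms by (intro bit_eqI) (auto simp: bits_def bit_take_bit_iff)
  then show ?thesis by (metis take_bit_nat_less_exp)
qed

section \<open>Seen, blocked and free bits\<close>

abbreviation term_bits :: "nat \<Rightarrow> nat set" where
  "term_bits n \<equiv> bits (two_up n)"

definition seen :: "nat \<Rightarrow> nat set" where
  "seen n = (\<Union>k<n. term_bits k)"

definition blocked :: "nat \<Rightarrow> nat set" where
  "blocked n = (\<Union>k\<in>{(n + 1) div 2..<n}. term_bits k)"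

definition free :: "nat \<Rightarrow> nat set" where
  "free n = seen n - blocked n"

text \<open>What survives the choice of a(n) and is passed on to the next step; the recursion for
  the free set is stated through it.\<close>

definition leftover :: "nat \<Rightarrow> nat set" where
  "leftover n = free n - term_bits n"

definition used :: "nat \<Rightarrow> nat set \<Rightarrow> bool" where
  "used n T \<longleftrightarrow> (\<exists>k<n. term_bits k = T)"

lemma usedI: "k < n \<Longrightarrow> term_bits k = T \<Longrightarrow> used n T"
  by (auto simp: used_def)

lemma used_mono: "used m T \<Longrightarrow> m \<le> n \<Longrightarrow> used n T"
  by (auto simp: used_def intro: less_le_trans)

lemma finite_seen [simp]: "finite (seen n)"
  by (simp add: seen_def)

lemma blocked_subset_seen: "blocked n \<subseteq> seen n"
  by (auto simp: blocked_def seen_def)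

lemma used_subset_seen: "used n T \<Longrightarrow> T \<subseteq> seen n"
  by (auto simp: used_def seen_def)

lemma seen_Suc: "seen (Suc n) = seen n \<union> term_bits n"
  by (auto simp: seen_def less_Suc_eq)

section \<open>Consequences of minimality\<close>

lemma two_up_eq_Least:
  "two_up n = (LEAST x. \<not> used n (bits x) \<and> bits x \<inter> blocked n = {})"
proof -
  have "((\<forall>k\<in>{0..<n}. x \<noteq> two_up k) \<and>
      (\<forall>k\<in>{(n + 1) div 2..<n}. perpendicular x (two_up k))) \<longleftrightarrow>
      \<not> used n (bits x) \<and> bits x \<inter> blocked n = {}" for x
    unfolding used_def blocked_def perpendicular_iff_bits bits_inject by fastforce
  then show ?thesis by (subst two_up.simps) simp
qed

lemma
  shows not_used_term_bits: "\<not> used n (term_bits n)"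
    and term_bits_disjoint_blocked: "term_bits n \<inter> blocked n = {}"
proof -
  \<comment> \<open>A power of two with an unseen exponent is admissible, so the
    \<open>LEAST\<close> is attained.\<close>
  obtain c where c: "c \<notin> seen n"
    using ex_new_if_finite[OF infinite_UNIV_nat finite_seen] by blast
  then have "\<not> used n (bits (2 ^ c)) \<and> bits (2 ^ c) \<inter> blocked n = {}"
    using used_subset_seen[of n "{c}"] blocked_subset_seen[of n] by auto
  then have "\<not> used n (term_bits n) \<and> term_bits n \<inter> blocked n = {}"
    unfolding two_up_eq_Least[of n] by (rule LeastI)
  then show "\<not> used n (term_bits n)" "term_bits n \<inter> blocked n = {}" by simp_all
qed

lemma two_up_le:
  "\<not> used n (bits x) \<Longrightarrow> bits x \<inter> blocked n = {} \<Longrightarrow> two_up n \<le> x"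
  unfolding two_up_eq_Least[of n] by (rule Least_le) simp

text \<open>A bit of a(n) that is not free cannot be blocked, so it is unseen and a(n) is at least
  \<open>2 ^ c\<close>. Since \<open>2 ^ c\<close> is itself admissible, equality holds.\<close>

lemma term_bits_not_seen:
  assumes "seen n = {..<c}" "\<not> term_bits n \<subseteq> free n"
  shows "term_bits n = {c}"
proof -
  obtain v where v: "v \<in> term_bits n" "v \<notin> free n" using assms(2) by blast
  then have "v \<notin> seen n"
    using term_bits_disjoint_blocked[of n] by (auto simp: free_def)
  then have "(2::nat) ^ c \<le> 2 ^ v" using assms(1) by simp
  also have "\<dots> \<le> two_up n"
    using v(1) by (intro bit_nat_imp_power_le) (simp add: bits_def)
  finally have "2 ^ c \<le> two_up n" .
  moreover have "two_up n \<le> 2 ^ c"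
    using used_subset_seen[of n "{c}"] blocked_subset_seen[of n] assms(1)
    by (intro two_up_le) auto
  ultimately have "two_up n = 2 ^ c" by simp
  then show ?thesis by simp
qed

text \<open>By the previous lemma new bits enter one at a time and in increasing order.\<close>

lemma ex_seen_eq_lessThan: "\<exists>c. seen n = {..<c}"
proof (induction n)
  case 0
  show ?case by (rule exI[of _ 0]) (simp add: seen_def)
next
  case (Suc n)
  then obtain c where c: "seen n = {..<c}" by blast
  show ?case
  proof (cases "term_bits n \<subseteq> free n")
    case True
    then have "seen (Suc n) = {..<c}" using c by (auto simp: seen_Suc free_def)
    then show ?thesis by blast
  next
    case False
    then have "seen (Suc n) = {..<Suc c}"
      using term_bits_not_seen[OF c] c by (simp add: seen_Suc lessThan_Suc)
    then show ?thesis by blast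
  qed
qed

lemma two_up_le_of_subset_free:
  assumes "T \<subseteq> free n" "\<not> used n T" "bits x = T"
  shows "two_up n \<le> x"
  using assms by (intro two_up_le) (auto simp: free_def)

text \<open>Records only that the bit is fresh, not that it is the least unseen one; freshness is
  what later arguments use.\<close>

definition novel :: "nat \<Rightarrow> bool" where
  "novel n \<longleftrightarrow> (\<exists>b. term_bits n = {b} \<and> b \<notin> seen n)"

lemma term_bits_subset_free:
  assumes "T \<subseteq> free n" "\<not> used n T"
  shows "term_bits n \<subseteq> free n"
proof (rule ccontr)
  assume notin: "\<not> term_bits n \<subseteq> free n"
  obtain c where c: "seen n = {..<c}" using ex_seen_eq_lessThan by blast
  have "finite T" using assms(1) by (rule finite_subset) (simp add: free_def)
  then obtain x where x: "bits x = T" using ex_bits_eq by blast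
  have "T \<subseteq> {..<c}" using assms(1) c by (auto simp: free_def)
  then have "x < 2 ^ c" using x by (intro bits_less_imp_less_power) simp
  moreover have "two_up n \<le> x" by (rule two_up_le_of_subset_free[OF assms x])
  moreover have "two_up n = 2 ^ c"
    using term_bits_not_seen[OF c notin] by (metis bits_inject bits_power_two)
  ultimately show False by simp
qed

text \<open>Inclusion of bit sets implies numerical order, so the least admissible number is also
  minimal for inclusion.\<close>

lemma term_bits_minimal:
  assumes "T \<subseteq> free n" "\<not> used n T" "T \<subseteq> term_bits n"
  shows "term_bits n = T"
proof -
  have "finite T" using assms(3) by (rule finite_subset) simp
  then obtain x where x: "bits x = T" using ex_bits_eq by blast
  have "two_up n \<le> x" by (rule two_up_le_of_subset_free[OF assms(1,2) x])
  moreover have "x \<le> two_up n" using assms(3) x by (intro bits_subset_imp_le) simp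
  ultimately show ?thesis using x by simp
qed

lemma novelI:
  assumes "\<And>T. T \<subseteq> free n \<Longrightarrow> used n T"
  shows "novel n" "leftover n = free n"
proof -
  obtain c where c: "seen n = {..<c}" using ex_seen_eq_lessThan by blast
  have "\<not> term_bits n \<subseteq> free n" using assms not_used_term_bits by blast
  then have "term_bits n = {c}" by (rule term_bits_not_seen[OF c])
  then show "novel n" "leftover n = free n"
    using c by (auto simp: novel_def leftover_def free_def)
qed

text \<open>A bit always makes its first appearance as a power of two. Hence a term made of free
  bits never has weight one.\<close>

lemma singleton_used:
  assumes "x \<in> seen n" shows "used n {x}"
  using assms
proof (induction n)
  case 0
  then show ?case by (simp add: seen_def)
next
  case (Suc n)
  obtain c where c: "seen n = {..<c}" using ex_seen_eq_lessThan by blast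
  consider "x \<in> seen n" | "x \<in> term_bits n" "x \<notin> seen n"
    using Suc.prems by (auto simp: seen_Suc)
  then show ?case
  proof cases
    case 1
    then show ?thesis using Suc.IH by (auto intro: used_mono)
  next
    case 2
    then have "\<not> term_bits n \<subseteq> free n" by (auto simp: free_def)
    then have "term_bits n = {c}" by (rule term_bits_not_seen[OF c])
    with 2 show ?thesis by (auto intro: usedI)
  qed
qed

lemma term_bits_0: "term_bits 0 = {}"
  using term_bits_subset_free[of "{}" 0] by (simp add: used_def free_def seen_def)

lemma empty_used: "0 < n \<Longrightarrow> used n {}"
  using term_bits_0 by (auto intro: usedI)

section \<open>Recursion for the free set\<close>

text \<open>Steps \<open>2 * m + 1\<close> and \<open>2 * m + 2\<close> share the lower end
  \<open>m + 1\<close> of the window, so no term is released in between.\<close>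

lemma free_even: "free (2 * m + 2) = leftover (2 * m + 1)"
proof -
  have "{(2 * m + 2 + 1) div 2..<2 * m + 2} = insert (2 * m + 1) {(2 * m + 1 + 1) div 2..<2 * m + 1}"
    by auto
  then have "blocked (2 * m + 2) = blocked (2 * m + 1) \<union> term_bits (2 * m + 1)"
    unfolding blocked_def by auto
  then show ?thesis
    using seen_Suc[of "2 * m + 1"] by (auto simp: free_def leftover_def)
qed

text \<open>Index \<open>m\<close> stays in the window up to and including step
  \<open>2 * m\<close>.\<close>

lemma term_bits_disjoint:
  assumes "m < k" "k \<le> 2 * m" shows "term_bits k \<inter> term_bits m = {}"
proof -
  have "m \<in> {(k + 1) div 2..<k}" using assms by auto
  then have "term_bits m \<subseteq> blocked k" unfolding blocked_def by blast
  then show ?thesis using term_bits_disjoint_blocked[of k] by blast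
qed

text \<open>The window drops \<open>m\<close> and gains \<open>2 * m\<close>. All terms from
  \<open>m + 1\<close> to \<open>2 * m\<close> had to avoid a(m), so none of its bits remains
  blocked.\<close>

lemma free_odd:
  assumes "0 < m"
  shows "free (2 * m + 1) = leftover (2 * m) \<union> term_bits m"
    and "leftover (2 * m) \<inter> term_bits m = {}"
proof -
  have old: "blocked (2 * m) = (\<Union>k\<in>{m + 1..<2 * m}. term_bits k) \<union> term_bits m"
  proof -
    have "{(2 * m + 1) div 2..<2 * m} = insert m {m + 1..<2 * m}" using assms by auto
    then show ?thesis unfolding blocked_def by auto
  qed
  have new: "blocked (2 * m + 1) = (\<Union>k\<in>{m + 1..<2 * m}. term_bits k) \<union> term_bits (2 * m)"
  proof -
    have "{(2 * m + 1 + 1) div 2..<2 * m + 1} = insert (2 * m) {m + 1..<2 * m}"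
      using assms by auto
    then show ?thesis unfolding blocked_def by auto
  qed
  have "term_bits k \<inter> term_bits m = {}" if "k \<in> {m + 1..<2 * m} \<union> {2 * m}" for k
    using term_bits_disjoint[of m k] assms that by auto
  then have "blocked (2 * m + 1) \<inter> term_bits m = {}"
    unfolding new by blast
  moreover have "term_bits m \<subseteq> seen (2 * m)"
    using assms by (auto simp: seen_def intro!: bexI[of _ m])
  ultimately show "free (2 * m + 1) = leftover (2 * m) \<union> term_bits m"
    using old new seen_Suc[of "2 * m"] by (auto simp: free_def leftover_def)
  show "leftover (2 * m) \<inter> term_bits m = {}"
    using old by (auto simp: leftover_def free_def)
qed

section \<open>Unpaired bits and pairs\<close>

definition unpaired :: "nat \<Rightarrow> nat \<Rightarrow> bool" where
  "unpaired n x \<longleftrightarrow> x \<in> seen n \<and> (\<forall>k<n. x \<in> term_bits k \<longrightarrow> term_bits k = {x})"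

lemma unpaired_Suc:
  assumes "unpaired n x" "x \<notin> term_bits n" shows "unpaired (Suc n) x"
  using assms by (auto simp: unpaired_def seen_Suc less_Suc_eq)

lemma unpaired_not_used:
  assumes "unpaired n x" "x \<noteq> y" shows "\<not> used n {x, y}"
proof
  assume "used n {x, y}"
  then obtain k where "k < n" "term_bits k = {x, y}" by (auto simp: used_def)
  then show False using assms by (auto simp: unpaired_def)
qed

lemma term_bits_persist:
  assumes "x \<in> term_bits i" "k < 2 * i + 1" "x \<in> term_bits k"
  shows "k \<le> i"
proof (rule ccontr)
  assume "\<not> k \<le> i"
  then show False using term_bits_disjoint[of i k] assms by auto
qed

text \<open>The bit is new at \<open>i\<close> and blocked through step \<open>2 * i\<close>, so it
  is still unpaired at step \<open>2 * i + 1\<close>, exactly when it is released.\<close>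

lemma novel_unpaired:
  assumes "novel i" obtains b where "term_bits i = {b}" "unpaired (2 * i + 1) b"
proof -
  obtain b where b: "term_bits i = {b}" "b \<notin> seen i"
    using assms by (auto simp: novel_def)
  have "term_bits k = {b}" if "k < 2 * i + 1" "b \<in> term_bits k" for k
  proof -
    have "k \<le> i" using term_bits_persist[of b i k] b(1) that by simp
    moreover have "\<not> k < i" using b(2) that by (auto simp: seen_def)
    ultimately have "k = i" by simp
    with b(1) show ?thesis by simp
  qed
  moreover have "b \<in> seen (2 * i + 1)"
    using b(1) by (auto simp: seen_def intro!: bexI[of _ i])
  ultimately show thesis using that b(1) by (auto simp: unpaired_def)
qed

definition pair :: "nat \<Rightarrow> bool" where
  "pair n \<longleftrightarrow> (\<exists>y z. y \<noteq> z \<and> term_bits n = {y, z})"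

text \<open>Remembers that one of the two bits was unpaired when the pair was formed;
  \<open>step_single_new_pair\<close> relies on this after their release.\<close>

definition new_pair :: "nat \<Rightarrow> bool" where
  "new_pair n \<longleftrightarrow> (\<exists>y z. y \<noteq> z \<and> unpaired n z \<and> term_bits n = {y, z})"

lemma new_pair_imp_pair: "new_pair n \<Longrightarrow> pair n"
  by (auto simp: new_pair_def pair_def)

section \<open>Terms chosen from at most three free bits\<close>

lemma subset_doubletonD:
  "T \<subseteq> {x, y} \<Longrightarrow> T = {} \<or> T = {x} \<or> T = {y} \<or> T = {x, y}"
  by blast

lemma subset_tripletonD:
  assumes "T \<subseteq> {x, y, z}"
  shows "T = {} \<or> T = {x} \<or> T = {y} \<or> T = {z} \<or>
    T = {x, y} \<or> T = {x, z} \<or> T = {y, z} \<or> T = {x, y, z}"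
proof (cases "x \<in> T")
  case True
  then obtain S where T: "T = insert x S" and "x \<notin> S" by (rule Set.set_insert)
  then have "S \<subseteq> {y, z}" using assms by blast
  from subset_doubletonD[OF this] show ?thesis
    unfolding T by (elim disjE) (simp_all only: simp_thms)
next
  case False
  then have "T \<subseteq> {y, z}" using assms by blast
  from subset_doubletonD[OF this] show ?thesis by (elim disjE) (simp_all only: simp_thms)
qed

lemma novel_of_small_free:
  assumes "0 < n" "free n = {} \<or> (\<exists>x. free n = {x}) \<or> (\<exists>x y. free n = {x, y} \<and> used n {x, y})"
  shows "novel n \<and> leftover n = free n"
proof -
  have "used n T" if T: "T \<subseteq> free n" for T
  proof -
    have sing: "used n {x}" if "x \<in> free n" for x
      using that by (intro singleton_used) (simp add: free_def)
    have emp: "used n {}" by (rule empty_used[OF assms(1)])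
    consider "free n = {}" | x where "free n = {x}"
      | x y where "free n = {x, y}" "used n {x, y}"
      using assms(2) by blast
    then show ?thesis
    proof cases
      case 1
      then show ?thesis using T emp by simp
    next
      case (2 x)
      then have "T = {} \<or> T = {x}" using T by (simp add: subset_singleton_iff)
      then show ?thesis using 2 emp sing[of x] by (elim disjE) simp_all
    next
      case (3 x y)
      then have "T = {} \<or> T = {x} \<or> T = {y} \<or> T = {x, y}"
        using T by (intro subset_doubletonD) simp
      then show ?thesis using 3 emp sing[of x] sing[of y] by (elim disjE) simp_all
    qed
  qed
  then show ?thesis using novelI by blast
qed

lemma pair_of_free_doubleton:
  assumes "free n = {x, y}" "x \<noteq> y" "\<not> used n {x, y}"
  shows "term_bits n = {x, y} \<and> leftover n = {}"
proof -
  have "\<And>v. v \<in> free n \<Longrightarrow> used n {v}"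
    by (intro singleton_used) (simp add: free_def)
  then have sing: "term_bits n \<noteq> {x}" "term_bits n \<noteq> {y}"
    using assms(1) not_used_term_bits[of n] by auto
  have sub: "term_bits n \<subseteq> {x, y}" using term_bits_subset_free[of "{x, y}" n] assms by simp
  have "0 < n" using assms(1) by (cases n) (auto simp: free_def seen_def)
  then have "term_bits n \<noteq> {}" using empty_used not_used_term_bits[of n] by auto
  with sing subset_doubletonD[OF sub] have "term_bits n = {x, y}" by blast
  then show ?thesis using assms(1) by (simp add: leftover_def)
qed

lemma pair_of_free_triple:
  assumes free: "free n = {x, y, z}" and dist: "x \<noteq> y" "x \<noteq> z" "y \<noteq> z"
    and yz: "used n {y, z}" and xz: "\<not> used n {x, z}"
  shows "pair n \<and> (leftover n = {y} \<or> leftover n = {z})"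
proof -
  have "\<And>v. v \<in> free n \<Longrightarrow> used n {v}"
    by (intro singleton_used) (simp add: free_def)
  then have sing: "term_bits n \<noteq> {x}" "term_bits n \<noteq> {y}" "term_bits n \<noteq> {z}"
    using free not_used_term_bits[of n] by auto
  have sub: "term_bits n \<subseteq> {x, y, z}" using term_bits_subset_free[of "{x, z}" n] free xz by simp
  have "0 < n" using free by (cases n) (auto simp: free_def seen_def)
  then have ne: "term_bits n \<noteq> {}" using empty_used not_used_term_bits[of n] by auto
  have "term_bits n \<noteq> {y, z}" using yz not_used_term_bits[of n] by auto
  moreover have "term_bits n \<noteq> {x, y, z}"
    using term_bits_minimal[of "{x, z}" n] free xz dist by auto
  ultimately consider "term_bits n = {x, y}" | "term_bits n = {x, z}"
    using subset_tripletonD[OF sub] sing ne by blast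
  then show ?thesis
    using free dist by cases (auto simp: leftover_def pair_def)
qed

section \<open>Steps 2m+1 and 2m+2, by the leftover of step 2m and the type of a(m)\<close>

lemma even_step:
  assumes "leftover (2 * m + 1) = {} \<or> (\<exists>x. leftover (2 * m + 1) = {x}) \<or>
    (\<exists>x y. leftover (2 * m + 1) = {x, y} \<and> used (2 * m + 2) {x, y})"
  shows "novel (2 * m + 2)" "leftover (2 * m + 2) = leftover (2 * m + 1)"
proof -
  have "novel (2 * m + 2) \<and> leftover (2 * m + 2) = free (2 * m + 2)"
    by (rule novel_of_small_free, simp, unfold free_even, rule assms)
  then show "novel (2 * m + 2)" "leftover (2 * m + 2) = leftover (2 * m + 1)"
    unfolding free_even by blast+
qed

lemma unpaired_leftover_even:
  assumes "unpaired (2 * m + 2) x" "x \<in> leftover (2 * m + 2)"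
  shows "unpaired (2 * m + 3) x"
  using unpaired_Suc[OF assms(1)] assms(2) by (simp add: leftover_def numeral_3_eq_3)

text \<open>The released bit is alone in the free set, so it survives both steps and stays
  unpaired.\<close>

lemma step_empty_novel:
  assumes "0 < m" "leftover (2 * m) = {}" "novel m"
  shows "novel (2 * m + 1)" "novel (2 * m + 2)"
    "\<exists>x. leftover (2 * m + 2) = {x} \<and> unpaired (2 * m + 3) x"
proof -
  obtain b where b: "term_bits m = {b}" "unpaired (2 * m + 1) b"
    using novel_unpaired[OF assms(3)] .
  have free: "free (2 * m + 1) = {b}" using free_odd(1)[OF assms(1)] assms(2) b(1) by simp
  then have nov: "novel (2 * m + 1)" and left: "leftover (2 * m + 1) = {b}"
    using novel_of_small_free[of "2 * m + 1"] by auto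
  show "novel (2 * m + 1)" by (rule nov)
  have "unpaired (2 * m + 2) b"
    using unpaired_Suc[OF b(2)] left by (auto simp: leftover_def)
  then show "novel (2 * m + 2)" "\<exists>x. leftover (2 * m + 2) = {x} \<and> unpaired (2 * m + 3) x"
    using even_step[of m] left unpaired_leftover_even[of m b] by auto
qed

text \<open>The only two-element set on offer is a(m) itself, already used, so both bits
  survive.\<close>

lemma step_empty_pair:
  assumes "0 < m" "leftover (2 * m) = {}" "pair m"
  shows "novel (2 * m + 1)" "novel (2 * m + 2)"
    "\<exists>y z. y \<noteq> z \<and> leftover (2 * m + 2) = {y, z} \<and> used (2 * m + 3) {y, z}"
proof -
  obtain y z where yz: "y \<noteq> z" "term_bits m = {y, z}" using assms(3) by (auto simp: pair_def)
  have u: "used n {y, z}" if "m < n" for n using yz(2) that by (auto intro: usedI)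
  have "free (2 * m + 1) = {y, z}" using free_odd(1)[OF assms(1)] assms(2) yz(2) by simp
  then have nov: "novel (2 * m + 1)" and left: "leftover (2 * m + 1) = {y, z}"
    using novel_of_small_free[of "2 * m + 1"] u[of "2 * m + 1"] by auto
  show "novel (2 * m + 1)" by (rule nov)
  have "\<exists>x y. leftover (2 * m + 1) = {x, y} \<and> used (2 * m + 2) {x, y}"
    using left u[of "2 * m + 2"] by auto
  then show "novel (2 * m + 2)"
    "\<exists>y z. y \<noteq> z \<and> leftover (2 * m + 2) = {y, z} \<and> used (2 * m + 3) {y, z}"
    using even_step[of m] left u[of "2 * m + 3"] yz(1) by auto
qed

lemma step_single_novel:
  assumes "0 < m" "leftover (2 * m) = {x}" "novel m"
  shows "new_pair (2 * m + 1)" "novel (2 * m + 2)" "leftover (2 * m + 2) = {}"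
proof -
  obtain b where b: "term_bits m = {b}" "unpaired (2 * m + 1) b"
    using novel_unpaired[OF assms(3)] .
  have xb: "x \<noteq> b" using free_odd(2)[OF assms(1)] assms(2) b(1) by auto
  have "free (2 * m + 1) = {x, b}" using free_odd(1)[OF assms(1)] assms(2) b(1) by auto
  moreover have "\<not> used (2 * m + 1) {x, b}"
    using unpaired_not_used[OF b(2), of x] xb by (simp add: insert_commute)
  ultimately have *: "term_bits (2 * m + 1) = {x, b}" "leftover (2 * m + 1) = {}"
    using pair_of_free_doubleton xb by auto
  then show "new_pair (2 * m + 1)" using xb b(2) by (auto simp: new_pair_def)
  show "novel (2 * m + 2)" "leftover (2 * m + 2) = {}" using even_step[of m] *(2) by auto
qed

lemma step_triple:
  assumes "0 < m" "leftover (2 * m) \<union> term_bits m = {x, y, z}"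
    and "x \<noteq> y" "x \<noteq> z" "y \<noteq> z" "used (2 * m + 1) {y, z}" "\<not> used (2 * m + 1) {x, z}"
  shows "pair (2 * m + 1)" "novel (2 * m + 2)" "\<exists>w. leftover (2 * m + 2) = {w}"
proof -
  have *: "pair (2 * m + 1) \<and> (leftover (2 * m + 1) = {y} \<or> leftover (2 * m + 1) = {z})"
    using assms free_odd(1)[OF assms(1)] by (intro pair_of_free_triple) auto
  then show "pair (2 * m + 1)" by simp
  show "novel (2 * m + 2)" "\<exists>w. leftover (2 * m + 2) = {w}" using even_step[of m] * by auto
qed

text \<open>The unpaired released bit takes the part of \<open>x\<close> in
  \<open>step_triple\<close>.\<close>

lemma step_double_novel:
  assumes "0 < m" "leftover (2 * m) = {y, z}" "y \<noteq> z" "used (2 * m + 1) {y, z}" "novel m"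
  shows "pair (2 * m + 1)" "novel (2 * m + 2)" "\<exists>w. leftover (2 * m + 2) = {w}"
proof -
  obtain b where b: "term_bits m = {b}" "unpaired (2 * m + 1) b"
    using novel_unpaired[OF assms(5)] .
  have ne: "b \<noteq> y" "b \<noteq> z" using free_odd(2)[OF assms(1)] assms(2) b(1) by auto
  have un: "leftover (2 * m) \<union> term_bits m = {b, y, z}" using assms(2) b(1) by auto
  note * = step_triple[OF assms(1) un ne assms(3,4) unpaired_not_used[OF b(2) ne(2)]]
  show "pair (2 * m + 1)" "novel (2 * m + 2)" "\<exists>w. leftover (2 * m + 2) = {w}"
    by (fact *)+
qed

text \<open>Here the leftover bit is the unpaired one, and the used pair is a(m).\<close>

lemma step_single_pair:
  assumes "0 < m" "leftover (2 * m) = {x}" "unpaired (2 * m + 1) x" "pair m"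
  shows "pair (2 * m + 1)" "novel (2 * m + 2)" "\<exists>w. leftover (2 * m + 2) = {w}"
proof -
  obtain y z where yz: "y \<noteq> z" "term_bits m = {y, z}" using assms(4) by (auto simp: pair_def)
  have ne: "x \<noteq> y" "x \<noteq> z" using free_odd(2)[OF assms(1)] assms(2) yz(2) by auto
  have un: "leftover (2 * m) \<union> term_bits m = {x, y, z}" using assms(2) yz(2) by auto
  have "used (2 * m + 1) {y, z}" using yz(2) by (auto intro: usedI[of m])
  note * = step_triple[OF assms(1) un ne yz(1) this unpaired_not_used[OF assms(3) ne(2)]]
  show "pair (2 * m + 1)" "novel (2 * m + 2)" "\<exists>w. leftover (2 * m + 2) = {w}"
    by (fact *)+
qed

text \<open>The bit of \<open>a(m)\<close> that was unpaired before index \<open>m\<close> has met only its partner in \<open>a(m)\<close>.\<close>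

lemma step_single_new_pair:
  assumes "0 < m" "leftover (2 * m) = {x}" "new_pair m"
  shows "pair (2 * m + 1)" "novel (2 * m + 2)" "\<exists>w. leftover (2 * m + 2) = {w}"
proof -
  obtain y z where yz: "y \<noteq> z" "unpaired m z" "term_bits m = {y, z}"
    using assms(3) by (auto simp: new_pair_def)
  have ne: "x \<noteq> y" "x \<noteq> z" using free_odd(2)[OF assms(1)] assms(2) yz(3) by auto
  have un: "leftover (2 * m) \<union> term_bits m = {x, y, z}" using assms(2) yz(3) by auto
  have u: "used (2 * m + 1) {y, z}" using yz(3) by (auto intro: usedI[of m])
  have "\<not> used (2 * m + 1) {x, z}"
  proof
    assume "used (2 * m + 1) {x, z}"
    then obtain k where k: "k < 2 * m + 1" "term_bits k = {x, z}" by (auto simp: used_def)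
    then have "k \<le> m" using term_bits_persist[of z m k] yz(3) by auto
    moreover have "k \<noteq> m" using k(2) yz(3) ne by auto
    ultimately have "k < m" by simp
    then show False using yz(2) k(2) ne by (auto simp: unpaired_def)
  qed
  note * = step_triple[OF assms(1) un ne yz(1) u this]
  show "pair (2 * m + 1)" "novel (2 * m + 2)" "\<exists>w. leftover (2 * m + 2) = {w}"
    by (fact *)+
qed

section \<open>Blocks of six terms and their doubling\<close>

definition regular_block :: "nat \<Rightarrow> bool" where
  "regular_block q \<longleftrightarrow> novel (6 * q + 3) \<and> novel (6 * q + 4) \<and> pair (6 * q + 5) \<and>
     novel (6 * q + 6) \<and> pair (6 * q + 7) \<and> novel (6 * q + 8)"

definition special_block :: "nat \<Rightarrow> bool" where
  "special_block q \<longleftrightarrow> new_pair (6 * q + 3) \<and> novel (6 * q + 4) \<and> novel (6 * q + 5) \<and>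
     novel (6 * q + 6) \<and> pair (6 * q + 7) \<and> novel (6 * q + 8)"

definition good_block :: "nat \<Rightarrow> bool" where
  "good_block q \<longleftrightarrow> regular_block q \<or> special_block q"

text \<open>The twelve steps release the terms \<open>6 * r + 1\<close> to \<open>6 * r + 6\<close>:
  the last two of block \<open>r - 1\<close>, of the same type in both patterns, and the first four
  of block \<open>r\<close>. The final leftover restores the assumption \<open>G\<close> for
  \<open>r + 1\<close>.\<close>

lemma good_blocks_double:
  assumes r: "0 < r" "good_block (r - 1)" "good_block r" and G: "leftover (12 * r + 2) = {}"
  shows "good_block (2 * r)" "good_block (2 * r + 1)" "leftover (12 * r + 14) = {}"
proof -
  obtain s where s: "r = Suc s" using r(1) by (cases r) auto
  have p: "pair (6 * r + 1)" and n: "novel (6 * r + 2)"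
    using r(2) by (auto simp: s good_block_def regular_block_def special_block_def eval_nat_numeral)
  note [simp del] = One_nat_def add_2_eq_Suc add_2_eq_Suc' add_Suc_right
  have 1: "novel (12 * r + 3)" "novel (12 * r + 4)"
    "\<exists>y z. y \<noteq> z \<and> leftover (12 * r + 4) = {y, z} \<and> used (12 * r + 5) {y, z}"
    using step_empty_pair[of "6 * r + 1"] p G by (auto simp: distrib_left add.assoc)
  then obtain y z where "y \<noteq> z" "leftover (12 * r + 4) = {y, z}" "used (12 * r + 5) {y, z}"
    by blast
  then have 2: "pair (12 * r + 5)" "novel (12 * r + 6)" "\<exists>w. leftover (12 * r + 6) = {w}"
    using step_double_novel[of "6 * r + 2" y z] n by (auto simp: distrib_left add.assoc)
  then obtain w where w: "leftover (12 * r + 6) = {w}" by blast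
  consider "regular_block r" | "special_block r" using r(3) by (auto simp: good_block_def)
  then have "good_block (2 * r) \<and> good_block (2 * r + 1) \<and> leftover (12 * r + 14) = {}"
  proof cases
    case 1
    then have t: "novel (6 * r + 3)" "novel (6 * r + 4)" "pair (6 * r + 5)" "novel (6 * r + 6)"
      by (auto simp: regular_block_def)
    have 3: "new_pair (12 * r + 7)" "novel (12 * r + 8)" "leftover (12 * r + 8) = {}"
      using step_single_novel[of "6 * r + 3" w] t(1) w by (auto simp: distrib_left add.assoc)
    have 4: "novel (12 * r + 9)" "novel (12 * r + 10)"
      "\<exists>x. leftover (12 * r + 10) = {x} \<and> unpaired (12 * r + 11) x"
      using step_empty_novel[of "6 * r + 4"] t(2) 3(3) by (auto simp: distrib_left add.assoc)
    then obtain x where "leftover (12 * r + 10) = {x}" "unpaired (12 * r + 11) x" by blast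
    \<comment> \<open>The unpaired bit kept since step \<open>12 * r + 10\<close> meets the pair
      released from index \<open>6 * r + 5\<close>.\<close>
    then have 5: "pair (12 * r + 11)" "novel (12 * r + 12)" "\<exists>w. leftover (12 * r + 12) = {w}"
      using step_single_pair[of "6 * r + 5" x] t(3) by (auto simp: distrib_left add.assoc)
    then have 6: "new_pair (12 * r + 13)" "novel (12 * r + 14)" "leftover (12 * r + 14) = {}"
      using step_single_novel[of "6 * r + 6"] t(4) by (auto simp: distrib_left add.assoc)
    show ?thesis
      using \<open>novel (12 * r + 3)\<close> \<open>novel (12 * r + 4)\<close> 2 3 4 5 6
      by (auto simp: good_block_def regular_block_def distrib_left add.assoc intro: new_pair_imp_pair)
  next
    case 2
    then have t: "new_pair (6 * r + 3)" "novel (6 * r + 4)" "novel (6 * r + 5)" "novel (6 * r + 6)"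
      by (auto simp: special_block_def)
    have 3: "pair (12 * r + 7)" "novel (12 * r + 8)" "\<exists>w. leftover (12 * r + 8) = {w}"
      using step_single_new_pair[of "6 * r + 3" w] t(1) w by (auto simp: distrib_left add.assoc)
    \<comment> \<open>The surplus bit is absorbed by the novel bit released from index
      \<open>6 * r + 4\<close>.\<close>
    then have 4: "new_pair (12 * r + 9)" "novel (12 * r + 10)" "leftover (12 * r + 10) = {}"
      using step_single_novel[of "6 * r + 4"] t(2) by (auto simp: distrib_left add.assoc)
    then have 5: "novel (12 * r + 11)" "novel (12 * r + 12)" "\<exists>x. leftover (12 * r + 12) = {x}"
      using step_empty_novel[of "6 * r + 5"] t(3) by (auto simp: distrib_left add.assoc)
    then have 6: "new_pair (12 * r + 13)" "novel (12 * r + 14)" "leftover (12 * r + 14) = {}"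
      using step_single_novel[of "6 * r + 6"] t(4) by (auto simp: distrib_left add.assoc)
    show ?thesis
      using \<open>novel (12 * r + 3)\<close> \<open>novel (12 * r + 4)\<close>
        \<open>pair (12 * r + 5)\<close> \<open>novel (12 * r + 6)\<close> 3 4 5 6
      by (auto simp: good_block_def regular_block_def special_block_def distrib_left add.assoc
          intro: new_pair_imp_pair)
  qed
  then show "good_block (2 * r)" "good_block (2 * r + 1)" "leftover (12 * r + 14) = {}" by auto
qed

section \<open>Initial terms and induction over the blocks\<close>

text \<open>Indices 3 to 8 follow neither pattern, since index 7 is novel rather than a pair. The
  terms up to 26 are therefore treated one by one; blocks 1, 2, 3 are special, and
  \<open>26 = 12 * 2 + 2\<close> is where doubling starts.\<close>

lemma initial_terms:
  shows "\<And>n. n \<in> {1, 2, 3, 4, 6, 7, 8} \<Longrightarrow> novel n" "pair 5"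
    "good_block 1" "good_block 2" "good_block 3" "leftover 26 = {}"
proof -
  have "free 1 = {}" using term_bits_0 by (simp add: free_def seen_def)
  then have 1: "novel 1" "leftover 1 = {}" using novel_of_small_free[of 1] by auto
  then have 2: "novel 2" "leftover 2 = {}" using even_step[of 0] by (auto simp: numeral_2_eq_2)
  have 3: "novel 3" "novel 4" "\<exists>x. leftover 4 = {x}"
    using step_empty_novel[of 1] 1 2 by auto
  then have 5: "new_pair 5" "novel 6" "leftover 6 = {}"
    using step_single_novel[of 2] 2 by auto
  then have 7: "novel 7" "novel 8" "\<exists>x. leftover 8 = {x}"
    using step_empty_novel[of 3] 3 by auto
  then have 9: "new_pair 9" "novel 10" "leftover 10 = {}"
    using step_single_novel[of 4] 3 by auto
  then have 11: "novel 11" "novel 12"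
    "\<exists>y z. y \<noteq> z \<and> leftover 12 = {y, z} \<and> used 13 {y, z}"
    using step_empty_pair[of 5] new_pair_imp_pair[OF 5(1)] by auto
  then have 13: "pair 13" "novel 14" "\<exists>w. leftover 14 = {w}"
    using step_double_novel[of 6] 5 by auto
  then have 15: "new_pair 15" "novel 16" "leftover 16 = {}"
    using step_single_novel[of 7] 7 by auto
  then have 17: "novel 17" "novel 18" "\<exists>x. leftover 18 = {x} \<and> unpaired 19 x"
    using step_empty_novel[of 8] 7 by auto
  then have 19: "pair 19" "novel 20" "\<exists>w. leftover 20 = {w}"
    using step_single_pair[of 9] new_pair_imp_pair[OF 9(1)] by auto
  then have 21: "new_pair 21" "novel 22" "leftover 22 = {}"
    using step_single_novel[of 10] 9 by auto
  then have 23: "novel 23" "novel 24" "\<exists>x. leftover 24 = {x}"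
    using step_empty_novel[of 11] 11 by auto
  then have 25: "new_pair 25" "novel 26" "leftover 26 = {}"
    using step_single_novel[of 12] 11 by auto
  show "\<And>n. n \<in> {1, 2, 3, 4, 6, 7, 8} \<Longrightarrow> novel n" using 1 2 3 5 7 by auto
  show "pair 5" by (rule new_pair_imp_pair[OF 5(1)])
  show "good_block 1" using 9 11 13 by (simp add: good_block_def special_block_def)
  show "good_block 2" using 15 17 19 by (simp add: good_block_def special_block_def)
  show "good_block 3"
    using 21 23 25 new_pair_imp_pair by (simp add: good_block_def special_block_def)
  show "leftover 26 = {}" by (rule 25(3))
qed

text \<open>For \<open>r \<ge> 2\<close> the blocks \<open>r - 1\<close> and \<open>r\<close> are
  among those already known, and doubling adds \<open>2 * r\<close> and
  \<open>2 * r + 1\<close>.\<close>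

lemma good_blocks_below:
  assumes "2 \<le> r"
  shows "(\<forall>q. 1 \<le> q \<and> q < 2 * r \<longrightarrow> good_block q) \<and> leftover (12 * r + 2) = {}"
  using assms
proof (induction r rule: dec_induct)
  case base
  have "q = 1 \<or> q = 2 \<or> q = 3" if "1 \<le> q" "q < 4" for q :: nat using that by auto
  then show ?case using initial_terms(3-6) by auto
next
  case (step r)
  have "1 \<le> r - 1 \<and> r - 1 < 2 * r" "1 \<le> r \<and> r < 2 * r" using step.hyps by auto
  then have "good_block (r - 1)" "good_block r" using step.IH by blast+
  moreover have "0 < r" using step.hyps by simp
  ultimately have double: "good_block (2 * r)" "good_block (2 * r + 1)" "leftover (12 * r + 14) = {}"
    using good_blocks_double step.IH by blast+
  have "good_block q" if "1 \<le> q" "q < 2 * Suc r" for q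
  proof -
    have "q < 2 * r \<or> q = 2 * r \<or> q = 2 * r + 1" using that by arith
    then show ?thesis using double(1,2) step.IH that(1) by blast
  qed
  moreover have "leftover (12 * Suc r + 2) = {}" using double(3) by (simp add: add.commute)
  ultimately show ?case by blast
qed

lemma good_block: "1 \<le> q \<Longrightarrow> good_block q"
  using good_blocks_below[of "q + 2"] by simp

lemma novel_or_pair:
  assumes "0 < n" shows "novel n \<or> pair n"
proof (cases "n < 9")
  case True
  then have "n \<in> {1, 2, 3, 4, 6, 7, 8} \<or> n = 5" using assms by auto
  then show ?thesis using initial_terms(1,2) by blast
next
  case False
  \<comment> \<open>Block \<open>q\<close> starts at \<open>6 * q + 3\<close>, whence the shift by
    3; from \<open>n = 9\<close> on it gives \<open>q \<ge> 1\<close>.\<close>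
  define q where "q = (n - 3) div 6"
  have "good_block q" using False by (intro good_block) (simp add: q_def)
  moreover have "n = 6 * q + 3 \<or> n = 6 * q + 4 \<or> n = 6 * q + 5 \<or>
      n = 6 * q + 6 \<or> n = 6 * q + 7 \<or> n = 6 * q + 8"
    using False unfolding q_def by presburger
  ultimately show ?thesis
    by (auto simp: good_block_def regular_block_def special_block_def intro: new_pair_imp_pair)
qed

theorem corollary4p2:
  fixes n :: nat
  assumes "two_up n \<noteq> 0"
  shows "weight (two_up n) = 1 \<or> weight (two_up n) = 2"
proof -
  have "0 < n" using assms term_bits_0 bits_inject[of "two_up 0" 0] by (cases n) auto
  then have "card (term_bits n) = 1 \<or> card (term_bits n) = 2"
    using novel_or_pair[of n] by (auto simp: novel_def pair_def)
  then show ?thesis by (simp add: weight_def bits_def)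
qed

end
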